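(* Let $T=[t_{ij}]_{n\times n}$ be a strictly lower triangular matrix with entries in $\mathbb{F}$. Then the abstract nil graded algebra $\mathcal{A}(T)$ is strongly associated to $T$; that is, $\dim_{\mathbb{F}}\mathcal{A}(T)=2^n$.
   Context: $\mathbb{F}$ is a field of characteristic different from $2$. For a strictly lower triangular matrix $T=[t_{ij}]_{n\times n}$ over $\mathbb{F}$, the abstract nil graded algebra $\mathcal{A}(T)$ is the commutative unital $\mathbb{F}$-algebra with generators $X_1,\dots,X_n$ and relations $X_1^2=0$ and $X_i^2=\sum_{j<i}t_{ij}X_jX_i$ for $i=2,\dots,n$, graded by $\deg(X_i)=2$. A commutative graded $\mathbb{F}$-algebra $\mathcal{A}$ generated by elements $X_1,\dots,X_n$ which are homogeneous of degree $2$ and satisfy these relations is called weakly associated to $T$; it is called strongly associated to $T$ if moreover $\dim_{\mathbb{F}}(\mathcal{A})=2^n$. (The algebra $\mathcal{A}(T)$ is weakly associated to $T$ by construction.) *)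

theory Defs
  imports
    "HOL-Library.Poly_Mapping"
    "HOL-Algebra.QuotRing"
    "HOL-Algebra.Subrings"
    "Jordan_Normal_Form.VS_Connect"
begin

text \<open>
  The ground field is a type \<open>'a\<close> of class \<^class>\<open>field\<close>, viewed as a ring record
  through \<^term>\<open>class_ring\<close>. Matrix indices and generators are numbered from \<open>0\<close>, so the
  relation for the first generator has an empty sum on its right-hand side.
\<close>

definition strictly_lower_triangular :: "'a::zero mat \<Rightarrow> bool" where
  "strictly_lower_triangular T \<longleftrightarrow>
     (\<forall>i < dim_row T. \<forall>j < dim_col T. i \<le> j \<longrightarrow> T $$ (i, j) = 0)"


subsection \<open>Commutative graded algebras\<close>

record ('a, 'b) graded_algebra = "('a, 'b) module" +
  component :: "int \<Rightarrow> 'b set"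

text \<open>
  The third conjunct says that the algebra is the direct sum of its components. Commutativity
  and the existence of a unit are part of the locale \<^locale>\<open>algebra\<close>.
\<close>

definition comm_graded_algebra :: "('a::field, 'b) graded_algebra \<Rightarrow> bool" where
  "comm_graded_algebra A \<longleftrightarrow>
     algebra class_ring A \<and>
     (\<forall>d. VectorSpace.subspace class_ring (component A d) A) \<and>
     (\<forall>a \<in> carrier A. \<exists>!f. (\<forall>d. f d \<in> component A d) \<and> finite {d. f d \<noteq> \<zero>\<^bsub>A\<^esub>} \<and>
        a = (\<Oplus>\<^bsub>A\<^esub>d \<in> {d. f d \<noteq> \<zero>\<^bsub>A\<^esub>}. f d)) \<and>
     (\<forall>d e. \<forall>x \<in> component A d. \<forall>y \<in> component A e. x \<otimes>\<^bsub>A\<^esub> y \<in> component A (d + e))"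

definition generates_algebra :: "('a::field, 'b, 'c) module_scheme \<Rightarrow> 'b set \<Rightarrow> bool" where
  "generates_algebra A S \<longleftrightarrow> S \<subseteq> carrier A \<and>
     (\<forall>B. subring B A \<and> VectorSpace.subspace class_ring B A \<and> S \<subseteq> B \<longrightarrow> B = carrier A)"


subsection \<open>Algebras associated to a matrix\<close>

definition weakly_associated :: "'a::field mat \<Rightarrow> ('a, 'b) graded_algebra \<Rightarrow> bool" where
  "weakly_associated T A \<longleftrightarrow>
     comm_graded_algebra A \<and>
     (\<exists>X :: nat \<Rightarrow> 'b.
        (\<forall>i < dim_row T. X i \<in> component A 2) \<and>
        generates_algebra A (X ` {..<dim_row T}) \<and>
        (\<forall>i < dim_row T.
           X i \<otimes>\<^bsub>A\<^esub> X i = (\<Oplus>\<^bsub>A\<^esub>j \<in> {..<i}. T $$ (i, j) \<odot>\<^bsub>A\<^esub> (X j \<otimes>\<^bsub>A\<^esub> X i))))"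

text \<open>
  \<^const>\<open>vectorspace.dim\<close> is a natural number even for spaces of infinite dimension, hence the
  separate finiteness condition.
\<close>

definition strongly_associated :: "'a::field mat \<Rightarrow> ('a, 'b) graded_algebra \<Rightarrow> bool" where
  "strongly_associated T A \<longleftrightarrow>
     weakly_associated T A \<and>
     vectorspace.fin_dim class_ring A \<and>
     vectorspace.dim class_ring A = 2 ^ dim_row T"


subsection \<open>The abstract nil graded algebra\<close>

text \<open>
  Polynomials are finitely supported functions from monomials to coefficients, and monomials are
  finitely supported functions from variables to exponents.
\<close>

type_synonym 'a mpoly = "(nat \<Rightarrow>\<^sub>0 nat) \<Rightarrow>\<^sub>0 'a"

definition Const :: "'a::zero \<Rightarrow> 'a mpoly" where
  "Const c = Poly_Mapping.single 0 c"

definition Var :: "nat \<Rightarrow> 'a::zero_neq_one mpoly" where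
  "Var i = Poly_Mapping.single (Poly_Mapping.single i 1) 1"

text \<open>The polynomial ring in the variables \<^term>\<open>Var i :: 'a::field mpoly\<close> with \<open>i < n\<close>.\<close>

definition mpoly_ring :: "nat \<Rightarrow> 'a::field mpoly ring" where
  "mpoly_ring n =
     \<lparr>carrier = {p. \<forall>m \<in> Poly_Mapping.keys p. Poly_Mapping.keys m \<subseteq> {..<n}},
      monoid.mult = (*), one = 1, zero = 0, add = (+)\<rparr>"

definition total_degree :: "(nat \<Rightarrow>\<^sub>0 nat) \<Rightarrow> nat" where
  "total_degree m = (\<Sum>i \<in> Poly_Mapping.keys m. Poly_Mapping.lookup m i)"

definition nil_relator :: "'a::field mat \<Rightarrow> nat \<Rightarrow> 'a mpoly" where
  "nil_relator T i = Var i ^ 2 - (\<Sum>j<i. Const (T $$ (i, j)) * Var j * Var i)"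

definition nil_ideal :: "'a::field mat \<Rightarrow> 'a mpoly set" where
  "nil_ideal T = genideal (mpoly_ring (dim_row T)) (nil_relator T ` {..<dim_row T})"

text \<open>
  A scalar \<open>c\<close> acts on the quotient as multiplication by the coset of the constant polynomial
  \<open>c\<close>. The component of degree \<open>d\<close> is the image of the polynomials that are homogeneous of
  degree \<open>d\<close> when each variable is given degree \<open>2\<close>.
\<close>

definition nil_algebra :: "'a::field mat \<Rightarrow> ('a, 'a mpoly set) graded_algebra" where
  "nil_algebra T = (let P = mpoly_ring (dim_row T); I = nil_ideal T; Q = P Quot I in
     \<lparr>carrier = carrier Q, monoid.mult = monoid.mult Q, one = one Q, zero = zero Q, add = add Q,
      smult = (\<lambda>c x. (I +>\<^bsub>P\<^esub> Const c) \<otimes>\<^bsub>Q\<^esub> x),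
      component = (\<lambda>d. {I +>\<^bsub>P\<^esub> p | p. p \<in> carrier P \<and>
        (\<forall>m \<in> Poly_Mapping.keys p. 2 * int (total_degree m) = d)})\<rparr>)"

end

theory Submission
  imports Defs
begin

text \<open>
  Write the \<open>k\<close>-th relation as \<open>X\<^sub>k\<^sup>2 = y\<^sub>k X\<^sub>k\<close>, where \<open>y\<^sub>k\<close> is a linear form in the variables
  \<open>X\<^sub>j\<close> with \<open>j < k\<close>. Replacing \<open>X\<^sub>k ^ (e + 1)\<close> by \<open>y\<^sub>k ^ e X\<^sub>k\<close> in every monomial is a linear map that
  kills the multiples of the \<open>k\<close>-th relator and commutes with multiplication by polynomials free
  of \<open>X\<^sub>k\<close>, in particular by the relators of smaller index. Applying these maps from the largest
  index down to \<open>0\<close> therefore gives a linear, degree preserving normal form that vanishes on the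
  ideal, changes a polynomial only by an element of the ideal, and takes values in the span of the
  squarefree monomials, which it fixes. So the \<open>2\<^sup>n\<close> squarefree monomials are a basis of the quotient.
\<close>

section \<open>Constants, supports and expansion into monomials\<close>

abbreviation keys where "keys \<equiv> Poly_Mapping.keys"
abbreviation lookup where "lookup \<equiv> Poly_Mapping.lookup"
abbreviation single where "single \<equiv> Poly_Mapping.single"

text \<open>Scalars enter as constant polynomials throughout; this rule recovers their
  coefficientwise action.\<close>

lemma lookup_Const_mult [simp]:
  fixes p :: "'a::comm_semiring_1 mpoly"
  shows "lookup (Const c * p) m = c * lookup p m"
  unfolding Const_def mult_map_scale_conv_mult[symmetric]
  by (simp add: Poly_Mapping.map.rep_eq when_def)

lemma Const_0 [simp]: "Const 0 = 0" and Const_1 [simp]: "Const (1::'a::comm_semiring_1) = 1"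
  by (simp_all add: Const_def)

lemma Const_add: "Const (a + b) = Const a + (Const b :: 'a::comm_semiring_1 mpoly)"
  by (simp add: Const_def single_add)

lemma Const_mult: "Const (a * b) = Const a * (Const b :: 'a::comm_semiring_1 mpoly)"
  by (simp add: Const_def mult_single)

lemma Const_mult_single [simp]: "Const c * single m (d::'a::comm_semiring_1) = single m (c * d)"
  by (simp add: Const_def mult_single)

lemma keys_Const_mult: "keys (Const c * p) \<subseteq> keys (p :: 'a::comm_semiring_1 mpoly)"
  by (auto simp: in_keys_iff)

lemma mem_keys_sum: "m \<in> keys (sum f A) \<Longrightarrow> \<exists>a\<in>A. m \<in> keys (f a)"
  by (metis in_keys_iff lookup_sum sum.neutral)

text \<open>\<open>S\<close> may exceed the support, so that a polynomial can also be expanded over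
  a fixed set, such as all squarefree monomials.\<close>

lemma poly_mapping_expand:
  fixes p :: "'b \<Rightarrow>\<^sub>0 'a::comm_monoid_add"
  assumes "finite S" "keys p \<subseteq> S"
  shows "p = (\<Sum>m\<in>S. single m (lookup p m))"
proof (rule poly_mapping_eqI)
  fix k
  have "(\<Sum>m\<in>S. lookup (single m (lookup p m)) k) = (\<Sum>m\<in>S. if m = k then lookup p k else 0)"
    by (rule sum.cong) (auto simp: lookup_single)
  also have "\<dots> = lookup p k"
    using assms by (auto simp: in_keys_iff)
  finally show "lookup p k = lookup (\<Sum>m\<in>S. single m (lookup p m)) k"
    by (simp add: lookup_sum)
qed

lemma poly_mapping_induct [case_names single add]:
  fixes p :: "'b \<Rightarrow>\<^sub>0 'a::comm_monoid_add"
  assumes "\<And>m c. Q (single m c)" "\<And>p q. Q p \<Longrightarrow> Q q \<Longrightarrow> Q (p + q)"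
  shows "Q p"
proof -
  have "Q (\<Sum>m\<in>S. single m (lookup p m))" if "finite S" for S
    using that
  proof (induction S)
    case empty
    \<comment> \<open>The zero polynomial counts as a single term with coefficient 0, so no separate
      zero case is required.\<close>
    show ?case using assms(1)[of undefined 0] by simp
  qed (simp add: assms)
  from this[of "keys p"] show ?thesis
    using poly_mapping_expand[of "keys p" p] by simp
qed


subsection \<open>Linear extension of maps on monomials\<close>

text \<open>The monomials form a basis of the polynomials, so values on monomials determine a linear
  map. Both the elimination maps and the projections to homogeneous parts arise in this way.\<close>

definition linear_ext :: "((nat \<Rightarrow>\<^sub>0 nat) \<Rightarrow> 'a mpoly) \<Rightarrow> 'a mpoly \<Rightarrow> 'a::comm_ring_1 mpoly" where
  "linear_ext f p = (\<Sum>m\<in>keys p. Const (lookup p m) * f m)"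

text \<open>Additivity needs one index set common to \<open>p\<close>, \<open>q\<close> and
  \<open>p + q\<close>, whose supports differ.\<close>

lemma linear_ext_superset:
  assumes "finite S" "keys p \<subseteq> S"
  shows "linear_ext f p = (\<Sum>m\<in>S. Const (lookup p m) * f m)"
  unfolding linear_ext_def using assms
  by (intro sum.mono_neutral_left) (auto simp: in_keys_iff)

lemma linear_ext_add: "linear_ext f (p + q) = linear_ext f p + linear_ext f q"
proof -
  have "keys (p + q) \<subseteq> keys p \<union> keys q" by (rule Poly_Mapping.keys_add)
  then show ?thesis
    by (simp add: linear_ext_superset[of "keys p \<union> keys q"] lookup_add Const_add
        sum.distrib distrib_right)
qed

lemma linear_ext_0 [simp]: "linear_ext f 0 = 0"
  by (simp add: linear_ext_def)

lemma linear_ext_single [simp]: "linear_ext f (single m c) = Const c * f m"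
  by (simp add: linear_ext_superset[of "{m}"])

lemma linear_ext_diff: "linear_ext f (p - q) = linear_ext f p - linear_ext f q"
  by (metis add_diff_cancel_right' diff_add_cancel linear_ext_add)

lemma keys_linear_ext: "m' \<in> keys (linear_ext f p) \<Longrightarrow> \<exists>m\<in>keys p. m' \<in> keys (f m)"
  unfolding linear_ext_def using keys_Const_mult by (blast dest: mem_keys_sum)


subsection \<open>Eliminating the powers of one variable\<close>

lemma total_degree_superset:
  "finite S \<Longrightarrow> keys m \<subseteq> S \<Longrightarrow> total_degree m = (\<Sum>i\<in>S. lookup m i)"
  unfolding total_degree_def by (intro sum.mono_neutral_left) (auto simp: in_keys_iff)

lemma total_degree_add [simp]: "total_degree (a + b) = total_degree a + total_degree b"
  using Poly_Mapping.keys_add[of a b]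
  by (simp add: total_degree_superset[of "keys a \<union> keys b"] lookup_add sum.distrib)

lemma total_degree_single [simp]: "total_degree (single i e) = e"
  by (simp add: total_degree_def)

lemma total_degree_0 [simp]: "total_degree 0 = 0"
  by (simp add: total_degree_def)

text \<open>Truncated subtraction makes \<open>e\<close> the number of surplus factors
  \<open>X\<^sub>k\<close>: it is 0 for exponents 0 and 1, and otherwise one factor is kept and the
  others become \<open>y\<close>.\<close>

definition reduce_monom :: "nat \<Rightarrow> 'a mpoly \<Rightarrow> (nat \<Rightarrow>\<^sub>0 nat) \<Rightarrow> 'a::comm_ring_1 mpoly" where
  "reduce_monom k y m =
     (let e = lookup m k - 1 in y ^ e * single (m - single k e) 1)"

abbreviation reduce where "reduce k y \<equiv> linear_ext (reduce_monom k y)"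

lemma reduce_monom_small: "lookup m k \<le> 1 \<Longrightarrow> reduce_monom k y m = single m 1"
  by (simp add: reduce_monom_def)

lemma reduce_monom_add:
  assumes "lookup a k = 0"
  shows "reduce_monom k y (a + b) = single a 1 * reduce_monom k y b"
proof -
  have "a + b - single k (lookup b k - 1) = a + (b - single k (lookup b k - 1))"
    using assms by (intro poly_mapping_eqI) (auto simp: lookup_add lookup_minus lookup_single when_def)
  then show ?thesis
    using assms by (simp add: reduce_monom_def Let_def lookup_add mult_single mult.left_commute[of "single a 1"])
qed

text \<open>The factor \<open>single k 1\<close> present on both sides is the one that is kept, so
  the additional one is surplus and turns into exactly one \<open>y\<close>.\<close>

lemma reduce_monom_square:
  "reduce_monom k y (single k 1 + (single k 1 + m)) = y * reduce_monom k y (single k 1 + m)"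
proof -
  have "single k 1 + (single k 1 + m) - single k (Suc (lookup m k))
      = single k 1 + m - single k (lookup m k)"
    by (intro poly_mapping_eqI) (auto simp: lookup_add lookup_minus lookup_single when_def)
  then show ?thesis
    by (simp add: reduce_monom_def Let_def lookup_add mult.assoc)
qed

text \<open>Elimination looks only at the exponent of \<open>k\<close>, so polynomials free of
  \<open>X\<^sub>k\<close> behave like scalars.\<close>

lemma reduce_mult:
  assumes "\<And>m. m \<in> keys q \<Longrightarrow> lookup m k = 0"
  shows "reduce k y (q * p) = q * reduce k y p"
proof -
  have mono: "reduce k y (single a c * p) = single a c * reduce k y p"
    if "lookup a k = 0" for a c
  proof (induction p rule: poly_mapping_induct)
    case (single m d)
    have "Const (c * d) * (single a 1 * reduce_monom k y m)
        = (Const c * single a 1) * (Const d * reduce_monom k y m)"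
      by (simp only: Const_mult mult_ac)
    then show ?case
      using that by (simp add: mult_single reduce_monom_add)
  qed (simp add: distrib_left linear_ext_add)
  \<comment> \<open>The induction runs over subsets of the support of \<open>q\<close>, so that
    every monomial met is free of \<open>X\<^sub>k\<close>.\<close>
  have "reduce k y ((\<Sum>m\<in>S. single m (lookup q m)) * p)
      = (\<Sum>m\<in>S. single m (lookup q m)) * reduce k y p" if "finite S" "S \<subseteq> keys q" for S
    using that by (induction S) (auto simp: distrib_right linear_ext_add mono assms)
  from this[of "keys q"] show ?thesis
    using poly_mapping_expand[of "keys q" q] by simp
qed

lemma reduce_Var_square: "reduce k y (Var k * (Var k * p)) = y * reduce k y (Var k * p)"
  by (induction p rule: poly_mapping_induct)
    (simp_all add: Var_def mult_single reduce_monom_square linear_ext_add distrib_left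
      mult.left_commute del: One_nat_def)

text \<open>Both terms of the expanded product are sent to
  \<open>y * reduce k y (Var k * p)\<close>: the first by \<open>reduce_Var_square\<close>, the
  second because \<open>y\<close> is free of \<open>X\<^sub>k\<close>.\<close>

lemma reduce_relator_mult:
  assumes "\<And>m. m \<in> keys y \<Longrightarrow> lookup m k = 0"
  shows "reduce k y ((Var k ^ 2 - y * Var k) * p) = 0"
proof -
  have "(Var k ^ 2 - y * Var k) * p = Var k * (Var k * p) - y * (Var k * p)"
    by (simp add: power2_eq_square algebra_simps)
  then show ?thesis
    using reduce_mult[of y k y, OF assms] by (simp add: linear_ext_diff reduce_Var_square)
qed

text \<open>Every surplus \<open>X\<^sub>k\<close> is traded for one variable of smaller index,
  which keeps the total degree and all exponents above \<open>k\<close>. Exponents below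
  \<open>k\<close> may grow, hence nothing is claimed about them.\<close>

lemma keys_reduce_monom:
  assumes y: "\<And>m. m \<in> keys y \<Longrightarrow> total_degree m = 1 \<and> (\<forall>j\<ge>k. lookup m j = 0)"
    and m': "m' \<in> keys (reduce_monom k y m)"
  shows "total_degree m' = total_degree m \<and> lookup m' k = min 1 (lookup m k) \<and>
    (\<forall>j>k. lookup m' j = lookup m j)"
proof -
  have pow: "total_degree a = e \<and> (\<forall>j\<ge>k. lookup a j = 0)" if "a \<in> keys (y ^ e)" for a e
    using that
  proof (induction e arbitrary: a)
    case (Suc e)
    then obtain b c where "a = b + c" "b \<in> keys y" "c \<in> keys (y ^ e)"
      using Poly_Mapping.keys_mult[of y "y ^ e"] by auto
    then show ?case using Suc.IH[of c] y[of b] by (simp add: lookup_add)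
  qed simp
  define e where "e = lookup m k - 1"
  have "m' \<in> keys (y ^ e * single (m - single k e) 1)"
    using m' by (simp add: reduce_monom_def e_def Let_def)
  then obtain a where a: "a \<in> keys (y ^ e)" "m' = a + (m - single k e)"
    using Poly_Mapping.keys_mult[of "y ^ e" "single (m - single k e) 1"]
    by (auto split: if_splits)
  \<comment> \<open>The subtraction is exact, as \<open>e\<close> never exceeds the exponent of
    \<open>k\<close>.\<close>
  have "m = single k e + (m - single k e)"
    by (intro poly_mapping_eqI) (auto simp: e_def lookup_add lookup_minus lookup_single when_def)
  then have "total_degree m = e + total_degree (m - single k e)"
    by (metis total_degree_add total_degree_single)
  with pow[OF a(1)] a(2) show ?thesis
    by (auto simp: lookup_add lookup_minus lookup_single e_def when_def)
qed


subsection \<open>Normal forms\<close>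

text \<open>This is the linear form \<open>y\<^sub>k\<close> for which the relation reads
  \<open>X\<^sub>k\<^sup>2 = y\<^sub>k X\<^sub>k\<close>.\<close>

definition linear_part :: "'a::field mat \<Rightarrow> nat \<Rightarrow> 'a mpoly" where
  "linear_part T k = (\<Sum>j<k. Const (T $$ (k, j)) * Var j)"

lemma nil_relator_eq: "nil_relator T k = Var k ^ 2 - linear_part T k * Var k"
  by (simp add: nil_relator_def linear_part_def sum_distrib_right)

lemma keys_Var: "keys (Var i :: 'a::zero_neq_one mpoly) = {single i 1}"
  by (simp add: Var_def)

lemma keys_linear_part: "m \<in> keys (linear_part T k) \<Longrightarrow> \<exists>j<k. m = single j 1"
  unfolding linear_part_def using keys_Const_mult keys_Var
  by (fastforce dest!: mem_keys_sum)

lemma keys_linear_part_degree: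
  "m \<in> keys (linear_part T k) \<Longrightarrow> total_degree m = 1 \<and> (\<forall>j\<ge>k. lookup m j = 0)"
  using keys_linear_part by (fastforce simp: lookup_single when_def)

text \<open>Index \<open>k\<close> is eliminated before the smaller ones, because the variables
  brought in by \<open>linear_part T k\<close> must still be reduced.\<close>

fun normal_form :: "'a::field mat \<Rightarrow> nat \<Rightarrow> 'a mpoly \<Rightarrow> 'a mpoly" where
  "normal_form T 0 p = p"
| "normal_form T (Suc k) p = normal_form T k (reduce k (linear_part T k) p)"

lemma normal_form_add: "normal_form T k (p + q) = normal_form T k p + normal_form T k q"
  by (induction k arbitrary: p q) (simp_all add: linear_ext_add)

lemma normal_form_0 [simp]: "normal_form T k 0 = 0"
  by (induction k) simp_all

lemma normal_form_diff: "normal_form T k (p - q) = normal_form T k p - normal_form T k q"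
  by (induction k arbitrary: p q) (simp_all add: linear_ext_diff)

text \<open>The degree clause yields the grading, the bound yields squarefreeness, and the last
  clause keeps the polynomial within its variables.\<close>

lemma keys_normal_form:
  "m' \<in> keys (normal_form T k p) \<Longrightarrow> \<exists>m\<in>keys p. total_degree m' = total_degree m \<and>
     (\<forall>j<k. lookup m' j \<le> 1) \<and> (\<forall>j\<ge>k. lookup m' j = lookup m j)"
proof (induction k arbitrary: p)
  case (Suc k)
  let ?y = "linear_part T k"
  have "m' \<in> keys (normal_form T k (reduce k ?y p))"
    using Suc.prems by simp
  from Suc.IH[OF this] obtain m1 where m1: "m1 \<in> keys (reduce k ?y p)"
    "total_degree m' = total_degree m1" "\<forall>j<k. lookup m' j \<le> 1"
    "\<forall>j\<ge>k. lookup m' j = lookup m1 j" by blast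
  from keys_linear_ext[OF m1(1)] obtain m where
    m: "m \<in> keys p" "m1 \<in> keys (reduce_monom k ?y m)" by blast
  have red: "total_degree m1 = total_degree m \<and> lookup m1 k = min 1 (lookup m k) \<and>
      (\<forall>j>k. lookup m1 j = lookup m j)"
    by (rule keys_reduce_monom[OF _ m(2)]) (rule keys_linear_part_degree)
  \<comment> \<open>At \<open>j = k\<close> the bound comes from the first elimination, and the
    later ones do not touch that exponent.\<close>
  have "lookup m' j \<le> 1" if "j < Suc k" for j
    using that m1(3,4) red by (cases "j = k") simp_all
  moreover have "lookup m' j = lookup m j" if "j \<ge> Suc k" for j
    using that m1(4) red by simp
  ultimately show ?case
    using m(1) m1(2) red by (intro bexI[of _ m]) simp_all
qed auto

text \<open>Exponents at most 1 leave no surplus factor, so each elimination map is the identity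
  here, whatever its \<open>y\<close>.\<close>

lemma normal_form_squarefree:
  assumes "\<And>m j. m \<in> keys p \<Longrightarrow> lookup m j \<le> 1"
  shows "normal_form T k p = p"
proof (induction k)
  case (Suc k)
  have "reduce k y p = p" for y
  proof -
    have "reduce k y p = (\<Sum>m\<in>keys p. single m (lookup p m))"
      unfolding linear_ext_def by (rule sum.cong) (simp_all add: reduce_monom_small assms del: One_nat_def)
    then show ?thesis using poly_mapping_expand[of "keys p" p] by simp
  qed
  with Suc show ?case by simp
qed simp

text \<open>The elimination at \<open>i\<close> kills the multiples of the \<open>i\<close>-th
  relator. Earlier eliminations let the relator pass as a factor and change only the cofactor, which
  is why \<open>p\<close> is arbitrary in the induction.\<close>

lemma normal_form_relator_mult:
  "i < k \<Longrightarrow> normal_form T k (nil_relator T i * p) = 0"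
proof (induction k arbitrary: p)
  case (Suc k)
  let ?y = "linear_part T k"
  show ?case
  proof (cases "i = k")
    case True
    then show ?thesis
      using reduce_relator_mult[of ?y k p] keys_linear_part_degree[of _ T k]
      by (simp add: nil_relator_eq)
  next
    case False
    with Suc.prems have "i < k" by simp
    \<comment> \<open>Only variables of index at most \<open>i\<close> occur in the relator, and
      \<open>i < k\<close>.\<close>
    have "lookup m k = 0" if "m \<in> keys (nil_relator T i)" for m
    proof -
      have *: "lookup m k = 0" if "m \<in> keys (q * Var i)" "\<And>m. m \<in> keys q \<Longrightarrow> lookup m k = 0"
        for m and q :: "'a mpoly"
        using that Poly_Mapping.keys_mult[of q "Var i"] \<open>i < k\<close>
        by (fastforce simp: keys_Var lookup_add lookup_single)
      have "lookup m k = 0" if "m \<in> keys (Var i :: 'a mpoly)" for m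
        using that \<open>i < k\<close> by (simp add: keys_Var lookup_single)
      moreover have "lookup m k = 0" if "m \<in> keys (linear_part T i)" for m
        using keys_linear_part_degree[OF that] \<open>i < k\<close> by simp
      moreover have "m \<in> keys (Var i ^ 2 :: 'a mpoly) \<or> m \<in> keys (linear_part T i * Var i)"
        using that by (auto simp: nil_relator_eq in_keys_iff lookup_minus)
      ultimately show ?thesis
        using *[of m "Var i"] *[of m "linear_part T i"] by (auto simp: power2_eq_square)
    qed
    then show ?thesis
      using Suc.IH[OF \<open>i < k\<close>] by (simp add: reduce_mult)
  qed
qed simp


subsection \<open>Reduction modulo the nil ideal\<close>

abbreviation polys where "polys n \<equiv> carrier (mpoly_ring n)"

lemma polys_iff: "p \<in> polys n \<longleftrightarrow> (\<forall>m\<in>keys p. \<forall>j\<ge>n. lookup m j = 0)"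
proof -
  have "keys m \<subseteq> {..<n} \<longleftrightarrow> (\<forall>j\<ge>n. lookup m j = 0)" for m :: "nat \<Rightarrow>\<^sub>0 nat"
    by (metis in_keys_iff lessThan_iff not_le subset_iff)
  then show ?thesis by (simp add: mpoly_ring_def)
qed

lemma mpoly_ring_simps [simp]:
  "monoid.mult (mpoly_ring n) = (*)" "one (mpoly_ring n) = 1" "zero (mpoly_ring n) = 0"
  "add (mpoly_ring n) = (+)"
  by (simp_all add: mpoly_ring_def)

lemma polys_0 [simp]: "0 \<in> polys n" and polys_1 [simp]: "1 \<in> polys n"
  by (simp_all add: polys_iff)

lemma polys_Const [simp]: "Const c \<in> polys n"
  by (simp add: polys_iff Const_def)

lemma polys_Var [simp]: "i < n \<Longrightarrow> Var i \<in> polys n"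
  by (simp add: polys_iff keys_Var lookup_single)

lemma polys_add [simp]: "p \<in> polys n \<Longrightarrow> q \<in> polys n \<Longrightarrow> p + q \<in> polys n"
  using Poly_Mapping.keys_add[of p q] by (auto simp: polys_iff)

lemma polys_mult [simp]: "p \<in> polys n \<Longrightarrow> q \<in> polys n \<Longrightarrow> p * q \<in> polys n"
  using Poly_Mapping.keys_mult[of p q] by (fastforce simp: polys_iff lookup_add)

lemma polys_uminus [simp]: "p \<in> polys n \<Longrightarrow> - p \<in> polys n"
  by (simp add: polys_iff in_keys_iff)

lemma polys_diff [simp]: "p \<in> polys n \<Longrightarrow> q \<in> polys n \<Longrightarrow> p - q \<in> polys n"
  using polys_add[of p n "- q"] by simp

lemma polys_power [simp]: "p \<in> polys n \<Longrightarrow> p ^ e \<in> polys n"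
  by (induction e) simp_all

lemma polys_sum: "(\<And>i. i \<in> S \<Longrightarrow> f i \<in> polys n) \<Longrightarrow> sum f S \<in> polys n"
  by (induction S rule: infinite_finite_induct) simp_all

lemma polys_linear_part [simp]: "k < n \<Longrightarrow> linear_part T k \<in> polys n"
  by (auto simp: linear_part_def intro!: polys_sum)

lemma polys_nil_relator [simp]: "k < n \<Longrightarrow> nil_relator T k \<in> polys n"
  by (simp add: nil_relator_eq)

lemma polys_reduce [simp]:
  assumes "k < n" "p \<in> polys n"
  shows "reduce k (linear_part T k) p \<in> polys n"
  unfolding polys_iff
proof (intro ballI allI impI)
  fix m' j
  assume m': "m' \<in> keys (reduce k (linear_part T k) p)" and "n \<le> j"
  then obtain m where m: "m \<in> keys p" "m' \<in> keys (reduce_monom k (linear_part T k) m)"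
    using keys_linear_ext by blast
  then have "\<forall>j>k. lookup m' j = lookup m j"
    using keys_reduce_monom[of "linear_part T k" k m' m] keys_linear_part_degree[of _ T k] by blast
  then show "lookup m' j = 0"
    using assms m(1) \<open>n \<le> j\<close> by (auto simp: polys_iff)
qed

lemma polys_normal_form [simp]: "k \<le> n \<Longrightarrow> p \<in> polys n \<Longrightarrow> normal_form T k p \<in> polys n"
  by (induction k arbitrary: p) simp_all

section \<open>The nil ideal in the polynomial ring\<close>

lemma cring_mpoly_ring: "cring (mpoly_ring n)"
proof (intro cringI abelian_groupI comm_monoidI)
  fix p :: "'a::field mpoly" assume "p \<in> polys n"
  then show "\<exists>q\<in>polys n. q \<oplus>\<^bsub>mpoly_ring n\<^esub> p = \<zero>\<^bsub>mpoly_ring n\<^esub>"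
    by (intro bexI[of _ "- p"]) simp_all
qed (simp_all add: algebra_simps)

lemma a_minus_mpoly_ring:
  assumes "p \<in> polys n" "q \<in> polys n"
  shows "p \<ominus>\<^bsub>mpoly_ring n\<^esub> q = p - q"
proof -
  interpret cring "mpoly_ring n :: 'a mpoly ring" by (rule cring_mpoly_ring)
  have "\<ominus>\<^bsub>mpoly_ring n\<^esub> q = - q"
    using assms by (intro minus_equality) simp_all
  then show ?thesis by (simp add: a_minus_def)
qed

lemma ideal_nil_ideal: "ideal (nil_ideal T) (mpoly_ring (dim_row T))"
proof -
  interpret cring "mpoly_ring (dim_row T) :: 'a mpoly ring" by (rule cring_mpoly_ring)
  show ?thesis
    unfolding nil_ideal_def by (rule genideal_ideal) auto
qed

lemma nil_ideal_add: "p \<in> nil_ideal T \<Longrightarrow> q \<in> nil_ideal T \<Longrightarrow> p + q \<in> nil_ideal T"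
  using additive_subgroup.a_closed[OF ideal.axioms(1)[OF ideal_nil_ideal]] by fastforce

lemma nil_ideal_0 [simp]: "0 \<in> nil_ideal T"
  using additive_subgroup.zero_closed[OF ideal.axioms(1)[OF ideal_nil_ideal]] by fastforce

lemma nil_ideal_mult:
  "p \<in> polys (dim_row T) \<Longrightarrow> q \<in> nil_ideal T \<Longrightarrow> p * q \<in> nil_ideal T"
  using ideal.I_l_closed[OF ideal_nil_ideal] by fastforce

lemma nil_ideal_sum: "(\<And>i. i \<in> S \<Longrightarrow> f i \<in> nil_ideal T) \<Longrightarrow> sum f S \<in> nil_ideal T"
  by (induction S rule: infinite_finite_induct) (simp_all add: nil_ideal_add)

lemma nil_relator_in_nil_ideal: "k < dim_row T \<Longrightarrow> nil_relator T k \<in> nil_ideal T"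
proof -
  assume "k < dim_row T"
  interpret cring "mpoly_ring (dim_row T) :: 'a mpoly ring" by (rule cring_mpoly_ring)
  have "nil_relator T ` {..<dim_row T} \<subseteq> nil_ideal T"
    unfolding nil_ideal_def by (rule genideal_self) auto
  with \<open>k < dim_row T\<close> show ?thesis by blast
qed

lemma Var_power: "Var k ^ e = (single (single k e) 1 :: 'a::comm_semiring_1 mpoly)"
  by (induction e) (simp_all add: Var_def mult_single single_add[symmetric])

text \<open>Modulo the ideal, \<open>X\<^sub>k ^ (e + 1)\<close> equals
  \<open>y ^ e X\<^sub>k\<close> by induction on \<open>e\<close>; multiplying by the part of
  \<open>m\<close> free of \<open>X\<^sub>k\<close> gives the claim.\<close>

lemma diff_reduce_monom_in_nil_ideal:
  assumes k: "k < dim_row T" and m: "single m 1 \<in> polys (dim_row T)"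
  shows "single m 1 - reduce_monom k (linear_part T k) m \<in> nil_ideal T"
proof (cases "lookup m k")
  case 0
  then show ?thesis by (simp add: reduce_monom_small)
next
  case (Suc e)
  let ?y = "linear_part T k"
  have pow: "Var k ^ Suc e - ?y ^ e * Var k \<in> nil_ideal T" for e
  proof (induction e)
    case (Suc e)
    \<comment> \<open>The term \<open>?y ^ e * Var k ^ 2\<close> is subtracted and added.\<close>
    have "Var k ^ Suc (Suc e) - ?y ^ Suc e * Var k
        = Var k * (Var k ^ Suc e - ?y ^ e * Var k) + ?y ^ e * nil_relator T k"
      by (simp add: nil_relator_eq power2_eq_square algebra_simps)
    then show ?case
      using Suc k by (simp add: nil_ideal_add nil_ideal_mult nil_relator_in_nil_ideal)
  qed simp
  \<comment> \<open>Since \<open>Suc e\<close> is the full exponent of \<open>k\<close>,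
    \<open>a\<close> is the part of \<open>m\<close> free of \<open>X\<^sub>k\<close>.\<close>
  define a where "a = m - single k (Suc e)"
  have a: "m = single k (Suc e) + a" "m - single k e = single k 1 + a"
    unfolding a_def using Suc
    by (auto intro!: poly_mapping_eqI simp: lookup_add lookup_minus lookup_single when_def)
  have "single a 1 \<in> (polys (dim_row T) :: 'a mpoly set)"
    using m by (auto simp: polys_iff a_def lookup_minus)
  then have "single a 1 * (Var k ^ Suc e - ?y ^ e * Var k) \<in> nil_ideal T"
    by (intro nil_ideal_mult pow)
  moreover have "single m 1 = single a 1 * (Var k ^ Suc e :: 'a mpoly)"
    by (simp only: Var_power mult_single a(1) add.commute[of a] mult_1_left)
  moreover have "reduce_monom k ?y m = single a 1 * (?y ^ e * Var k)"
    using Suc a(2)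
    by (simp add: reduce_monom_def Var_def mult_single add.commute
        mult.left_commute[of "single a 1"])
  ultimately show ?thesis by (simp add: right_diff_distrib)
qed

lemma diff_reduce_in_nil_ideal:
  assumes "k < dim_row T" "p \<in> polys (dim_row T)"
  shows "p - reduce k (linear_part T k) p \<in> nil_ideal T"
proof -
  let ?y = "linear_part T k"
  have "p - reduce k ?y p
      = (\<Sum>m\<in>keys p. single m (lookup p m)) - (\<Sum>m\<in>keys p. Const (lookup p m) * reduce_monom k ?y m)"
    using poly_mapping_expand[of "keys p" p] by (simp add: linear_ext_def)
  also have "\<dots> = (\<Sum>m\<in>keys p. Const (lookup p m) * (single m 1 - reduce_monom k ?y m))"
    by (simp add: sum_subtractf right_diff_distrib)
  also have "\<dots> \<in> nil_ideal T"
  proof (intro nil_ideal_sum nil_ideal_mult diff_reduce_monom_in_nil_ideal)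
    fix m assume "m \<in> keys p"
    with assms(2) show "single m 1 \<in> (polys (dim_row T) :: 'a mpoly set)"
      by (simp add: polys_iff)
  qed (simp_all add: assms(1))
  finally show ?thesis .
qed

text \<open>Each elimination changes the polynomial by an element of the ideal, and these
  differences telescope.\<close>

lemma diff_normal_form_in_nil_ideal:
  "k \<le> dim_row T \<Longrightarrow> p \<in> polys (dim_row T) \<Longrightarrow> p - normal_form T k p \<in> nil_ideal T"
proof (induction k arbitrary: p)
  case (Suc k)
  let ?q = "reduce k (linear_part T k) p"
  have "p - normal_form T (Suc k) p = (p - ?q) + (?q - normal_form T k ?q)" by simp
  moreover have "p - ?q \<in> nil_ideal T" "?q - normal_form T k ?q \<in> nil_ideal T"
    using Suc by (simp_all add: diff_reduce_in_nil_ideal)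
  ultimately show ?case
    by (metis nil_ideal_add)
qed simp

section \<open>The nil ideal as the kernel of the normal form\<close>

abbreviation nf where "nf T \<equiv> normal_form T (dim_row T)"

text \<open>By minimality of the generated ideal, one ideal that contains the relators and on which
  \<open>nf T\<close> vanishes is enough.\<close>

lemma nil_ideal_normal_form:
  assumes "p \<in> nil_ideal T"
  shows "nf T p = 0"
proof -
  interpret cring "mpoly_ring (dim_row T) :: 'a mpoly ring" by (rule cring_mpoly_ring)
  \<comment> \<open>The kernel of \<^term>\<open>nf T\<close> is not evidently an ideal, the following part of it is.\<close>
  define J where "J = {p \<in> polys (dim_row T). \<forall>q. nf T (p * q) = 0}"
  have "ideal J (mpoly_ring (dim_row T))"
  proof (rule idealI)
    show "subgroup J (add_monoid (mpoly_ring (dim_row T)))"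
    proof (rule add.subgroupI)
      have "0 \<in> J" by (simp add: J_def)
      then show "J \<noteq> {}" by blast
    next
      fix p assume p: "p \<in> J"
      then have "p \<in> polys (dim_row T)" by (simp add: J_def)
      then have "\<ominus>\<^bsub>mpoly_ring (dim_row T)\<^esub> p = - p"
        by (intro minus_equality) simp_all
      then show "\<ominus>\<^bsub>mpoly_ring (dim_row T)\<^esub> p \<in> J"
        using p normal_form_diff[of T "dim_row T" 0] by (simp add: J_def)
    qed (auto simp: J_def distrib_right normal_form_add)
  next
    fix p q :: "'a mpoly"
    assume *: "p \<in> J" "q \<in> polys (dim_row T)"
    then show "p \<otimes>\<^bsub>mpoly_ring (dim_row T)\<^esub> q \<in> J"
      by (simp add: J_def mult.assoc)
    with * show "q \<otimes>\<^bsub>mpoly_ring (dim_row T)\<^esub> p \<in> J"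
      by (simp add: mult.commute)
  qed (rule ring_axioms)
  moreover have "nil_relator T ` {..<dim_row T} \<subseteq> J"
    by (auto simp: J_def normal_form_relator_mult)
  ultimately have "nil_ideal T \<subseteq> J"
    unfolding nil_ideal_def by (rule genideal_minimal)
  with assms have "\<forall>q. nf T (p * q) = 0" by (auto simp: J_def)
  \<comment> \<open>The cofactor 1 gives back \<open>nf T p\<close> itself.\<close>
  from spec[OF this, of 1] show ?thesis by simp
qed

text \<open>If the normal form vanishes, then \<open>p\<close> is its own difference from its normal
  form, which lies in the ideal.\<close>

lemma nil_ideal_iff:
  assumes "p \<in> polys (dim_row T)"
  shows "p \<in> nil_ideal T \<longleftrightarrow> nf T p = 0"
  using nil_ideal_normal_form diff_normal_form_in_nil_ideal[OF order_refl assms] by fastforce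


subsection \<open>The quotient algebra\<close>

text \<open>Naming the projection lets every operation of the quotient be computed on
  representatives.\<close>

definition coset :: "'a::field mat \<Rightarrow> 'a mpoly \<Rightarrow> 'a mpoly set" where
  "coset T p = nil_ideal T +>\<^bsub>mpoly_ring (dim_row T)\<^esub> p"

lemma coset_eq_iff:
  assumes "p \<in> polys (dim_row T)" "q \<in> polys (dim_row T)"
  shows "coset T p = coset T q \<longleftrightarrow> nf T p = nf T q"
proof -
  interpret cring "mpoly_ring (dim_row T) :: 'a mpoly ring" by (rule cring_mpoly_ring)
  show ?thesis
    using quotient_eq_iff_same_a_r_cos[OF ideal_nil_ideal assms] assms
    by (simp add: coset_def a_minus_mpoly_ring nil_ideal_iff normal_form_diff)
qed

lemma carrier_nil_algebra: "carrier (nil_algebra T) = coset T ` polys (dim_row T)"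
  by (auto simp: nil_algebra_def Let_def FactRing_def A_RCOSETS_def RCOSETS_def coset_def
      a_r_coset_def)

lemma coset_add:
  assumes "p \<in> polys (dim_row T)" "q \<in> polys (dim_row T)"
  shows "coset T p \<oplus>\<^bsub>nil_algebra T\<^esub> coset T q = coset T (p + q)"
proof -
  interpret ideal "nil_ideal T" "mpoly_ring (dim_row T)" by (rule ideal_nil_ideal)
  show ?thesis
    using a_rcos_sum[OF assms] by (simp add: nil_algebra_def Let_def FactRing_def coset_def)
qed

lemma coset_mult:
  assumes "p \<in> polys (dim_row T)" "q \<in> polys (dim_row T)"
  shows "coset T p \<otimes>\<^bsub>nil_algebra T\<^esub> coset T q = coset T (p * q)"
proof -
  interpret ideal "nil_ideal T" "mpoly_ring (dim_row T)" by (rule ideal_nil_ideal)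
  show ?thesis
    using rcoset_mult_add[OF assms] by (simp add: nil_algebra_def Let_def FactRing_def coset_def)
qed

lemma coset_smult:
  assumes "p \<in> polys (dim_row T)"
  shows "c \<odot>\<^bsub>nil_algebra T\<^esub> coset T p = coset T (Const c * p)"
  using coset_mult[OF polys_Const assms, of c]
  by (simp add: nil_algebra_def Let_def coset_def)

lemma one_nil_algebra: "\<one>\<^bsub>nil_algebra T\<^esub> = coset T 1"
  by (simp add: nil_algebra_def Let_def FactRing_def coset_def)

text \<open>The zero of the quotient ring is defined as the ideal itself, which is the coset of
  0.\<close>

lemma zero_nil_algebra: "\<zero>\<^bsub>nil_algebra T\<^esub> = coset T 0"
  by (simp add: nil_algebra_def Let_def FactRing_def coset_def a_r_coset_def')

lemmas coset_simps = coset_add coset_mult coset_smult one_nil_algebra zero_nil_algebra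

text \<open>The zero polynomial is homogeneous of every degree, so odd and negative degrees get the
  zero component.\<close>

definition homogeneous :: "int \<Rightarrow> 'a::zero mpoly \<Rightarrow> bool" where
  "homogeneous d p \<longleftrightarrow> (\<forall>m\<in>keys p. 2 * int (total_degree m) = d)"

lemma component_nil_algebra:
  "component (nil_algebra T) d = coset T ` {p \<in> polys (dim_row T). homogeneous d p}"
  by (auto simp: nil_algebra_def Let_def coset_def homogeneous_def)

lemma coset_normal_form: "p \<in> polys (dim_row T) \<Longrightarrow> coset T (nf T p) = coset T p"
proof -
  assume p: "p \<in> polys (dim_row T)"
  have "nf T (p - nf T p) = 0"
    using nil_ideal_normal_form[OF diff_normal_form_in_nil_ideal[OF order_refl p]] .
  with p show ?thesis by (simp add: coset_eq_iff normal_form_diff)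
qed

lemma cring_nil_algebra: "cring (nil_algebra T)"
proof (intro cringI abelian_groupI comm_monoidI)
  fix a assume "a \<in> carrier (nil_algebra T)"
  then obtain p where "p \<in> polys (dim_row T)" "a = coset T p"
    by (auto simp: carrier_nil_algebra)
  then show "\<exists>b\<in>carrier (nil_algebra T). b \<oplus>\<^bsub>nil_algebra T\<^esub> a = \<zero>\<^bsub>nil_algebra T\<^esub>"
    by (intro bexI[of _ "coset T (- p)"]) (auto simp: carrier_nil_algebra coset_simps)
qed (auto simp: carrier_nil_algebra coset_simps ac_simps distrib_left)

lemma algebra_nil_algebra: "algebra class_ring (nil_algebra T)"
proof (rule algebraI[OF class_cring.cring_axioms cring_nil_algebra])
  fix c x assume "x \<in> carrier (nil_algebra T)"
  then obtain p where p: "p \<in> polys (dim_row T)" "x = coset T p"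
    unfolding carrier_nil_algebra by blast
  then show "c \<odot>\<^bsub>nil_algebra T\<^esub> x \<in> carrier (nil_algebra T)"
    and "\<one>\<^bsub>class_ring\<^esub> \<odot>\<^bsub>nil_algebra T\<^esub> x = x"
    by (simp_all add: carrier_nil_algebra coset_smult)
  show "(c \<oplus>\<^bsub>class_ring\<^esub> d) \<odot>\<^bsub>nil_algebra T\<^esub> x
      = c \<odot>\<^bsub>nil_algebra T\<^esub> x \<oplus>\<^bsub>nil_algebra T\<^esub> d \<odot>\<^bsub>nil_algebra T\<^esub> x" for d
    using p by (simp add: coset_smult coset_add Const_add distrib_right)
  show "(c \<otimes>\<^bsub>class_ring\<^esub> d) \<odot>\<^bsub>nil_algebra T\<^esub> x
      = c \<odot>\<^bsub>nil_algebra T\<^esub> (d \<odot>\<^bsub>nil_algebra T\<^esub> x)" for d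
    using p by (simp add: coset_smult Const_mult mult.assoc)
  fix y assume "y \<in> carrier (nil_algebra T)"
  then obtain q where q: "q \<in> polys (dim_row T)" "y = coset T q"
    unfolding carrier_nil_algebra by blast
  show "c \<odot>\<^bsub>nil_algebra T\<^esub> (x \<oplus>\<^bsub>nil_algebra T\<^esub> y)
      = c \<odot>\<^bsub>nil_algebra T\<^esub> x \<oplus>\<^bsub>nil_algebra T\<^esub> c \<odot>\<^bsub>nil_algebra T\<^esub> y"
    using p q by (simp add: coset_smult coset_add distrib_left)
  show "(c \<odot>\<^bsub>nil_algebra T\<^esub> x) \<otimes>\<^bsub>nil_algebra T\<^esub> y
      = c \<odot>\<^bsub>nil_algebra T\<^esub> (x \<otimes>\<^bsub>nil_algebra T\<^esub> y)"
    using p q by (simp add: coset_smult coset_mult mult.assoc)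
qed

lemma vectorspace_nil_algebra: "vectorspace class_ring (nil_algebra T)"
  by (rule vectorspace.intro[OF algebra.axioms(1)[OF algebra_nil_algebra] class_field.field_axioms])

lemma coset_sum:
  assumes "\<And>i. i \<in> S \<Longrightarrow> f i \<in> polys (dim_row T)" "finite S"
  shows "(\<Oplus>\<^bsub>nil_algebra T\<^esub>i\<in>S. coset T (f i)) = coset T (\<Sum>i\<in>S. f i)"
proof -
  interpret cring "nil_algebra T" by (rule cring_nil_algebra)
  show ?thesis
    using assms(2,1)
  proof (induction S)
    case (insert i S)
    have "(\<lambda>i. coset T (f i)) \<in> S \<rightarrow> carrier (nil_algebra T)"
      using insert.prems by (auto simp: carrier_nil_algebra)
    moreover have "coset T (f i) \<in> carrier (nil_algebra T)"
      using insert.prems by (auto simp: carrier_nil_algebra)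
    ultimately show ?case
      using insert by (simp add: finsum_insert coset_add polys_sum)
  qed (simp add: zero_nil_algebra)
qed


subsection \<open>The grading\<close>

lemma linear_ext_sum: "linear_ext f (sum g S) = (\<Sum>i\<in>S. linear_ext f (g i))"
  by (induction S rule: infinite_finite_induct) (simp_all add: linear_ext_add)

lemma normal_form_sum: "normal_form T k (sum g S) = (\<Sum>i\<in>S. normal_form T k (g i))"
  by (induction S rule: infinite_finite_induct) (simp_all add: normal_form_add)

definition homogeneous_part :: "int \<Rightarrow> 'a mpoly \<Rightarrow> 'a::comm_ring_1 mpoly" where
  "homogeneous_part d =
     linear_ext (\<lambda>m. if 2 * int (total_degree m) = d then single m 1 else 0)"

lemma keys_homogeneous_part:
  "m \<in> keys (homogeneous_part d p) \<Longrightarrow> m \<in> keys p \<and> 2 * int (total_degree m) = d"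
  unfolding homogeneous_part_def by (drule keys_linear_ext) (auto split: if_splits)

lemma homogeneous_homogeneous_part: "homogeneous d (homogeneous_part d p)"
  using keys_homogeneous_part by (auto simp: homogeneous_def)

lemma polys_homogeneous_part [simp]: "p \<in> polys n \<Longrightarrow> homogeneous_part d p \<in> polys n"
  using keys_homogeneous_part by (auto simp: polys_iff)

lemma homogeneous_part_homogeneous:
  assumes "homogeneous e p"
  shows "homogeneous_part d p = (if d = e then p else 0)"
proof -
  have "homogeneous_part d p = (\<Sum>m\<in>keys p. if d = e then single m (lookup p m) else 0)"
    unfolding homogeneous_part_def linear_ext_def
    using assms by (intro sum.cong) (auto simp: homogeneous_def)
  then show ?thesis
    using poly_mapping_expand[of "keys p" p] by simp
qed

text \<open>After exchanging the sums, each monomial of \<open>p\<close> contributes in exactly one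
  degree, namely its own.\<close>

lemma sum_homogeneous_part:
  "(\<Sum>d\<in>(\<lambda>m. 2 * int (total_degree m)) ` keys p. homogeneous_part d p) = p"
proof -
  let ?deg = "\<lambda>m. 2 * int (total_degree m)"
  have "(\<Sum>d\<in>?deg ` keys p. homogeneous_part d p)
      = (\<Sum>m\<in>keys p. \<Sum>d\<in>?deg ` keys p. if ?deg m = d then single m (lookup p m) else 0)"
    unfolding homogeneous_part_def linear_ext_def
    by (subst sum.swap) (intro sum.cong, auto)
  also have "\<dots> = (\<Sum>m\<in>keys p. single m (lookup p m))"
    by (intro sum.cong) (auto simp: sum.delta)
  finally show ?thesis
    using poly_mapping_expand[of "keys p" p] by simp
qed

lemma homogeneous_add: "homogeneous d p \<Longrightarrow> homogeneous d q \<Longrightarrow> homogeneous d (p + q)"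
  using Poly_Mapping.keys_add[of p q] by (auto simp: homogeneous_def)

lemma homogeneous_mult: "homogeneous d p \<Longrightarrow> homogeneous e q \<Longrightarrow> homogeneous (d + e) (p * q)"
  using Poly_Mapping.keys_mult[of p q] by (fastforce simp: homogeneous_def)

lemma homogeneous_Const_mult: "homogeneous d p \<Longrightarrow> homogeneous d (Const c * p)"
  for p :: "'a::comm_semiring_1 mpoly"
  using keys_Const_mult[of c p] by (auto simp: homogeneous_def)

lemma homogeneous_normal_form: "homogeneous d p \<Longrightarrow> homogeneous d (normal_form T k p)"
  unfolding homogeneous_def by (metis keys_normal_form)

lemma subspace_component:
  "VectorSpace.subspace class_ring (component (nil_algebra T) d) (nil_algebra T)"
proof (intro subspace.intro submodule.intro)
  show "vectorspace class_ring (nil_algebra T)"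
    by (rule vectorspace_nil_algebra)
  show "module class_ring (nil_algebra T)"
    by (rule algebra.axioms(1)[OF algebra_nil_algebra])
  show "component (nil_algebra T) d \<subseteq> carrier (nil_algebra T)"
    by (auto simp: component_nil_algebra carrier_nil_algebra)
  show "\<zero>\<^bsub>nil_algebra T\<^esub> \<in> component (nil_algebra T) d"
    by (simp add: component_nil_algebra zero_nil_algebra homogeneous_def)
next
  fix v w assume "v \<in> component (nil_algebra T) d" "w \<in> component (nil_algebra T) d"
  then show "v \<oplus>\<^bsub>nil_algebra T\<^esub> w \<in> component (nil_algebra T) d"
    by (auto simp: component_nil_algebra coset_add homogeneous_add)
next
  fix c v assume "v \<in> component (nil_algebra T) d"
  then show "c \<odot>\<^bsub>nil_algebra T\<^esub> v \<in> component (nil_algebra T) d"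
    by (auto simp: component_nil_algebra coset_smult homogeneous_Const_mult)
qed

text \<open>The homogeneous parts of the normal form give existence. For uniqueness, equal cosets
  have equal normal forms, and these can be compared degree by degree.\<close>

lemma component_decomposition:
  fixes T :: "'a::field mat"
  assumes "a \<in> carrier (nil_algebra T)"
  shows "\<exists>!f. (\<forall>d. f d \<in> component (nil_algebra T) d) \<and> finite {d. f d \<noteq> \<zero>\<^bsub>nil_algebra T\<^esub>} \<and>
    a = (\<Oplus>\<^bsub>nil_algebra T\<^esub>d \<in> {d. f d \<noteq> \<zero>\<^bsub>nil_algebra T\<^esub>}. f d)"
proof -
  let ?A = "nil_algebra T"
  interpret cring ?A by (rule cring_nil_algebra)
  from assms obtain p where p: "p \<in> polys (dim_row T)" "a = coset T p"
    unfolding carrier_nil_algebra by blast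
  define f where "f d = coset T (homogeneous_part d (nf T p))" for d
  define D where "D = (\<lambda>m. 2 * int (total_degree m)) ` keys (nf T p)"
  have nf: "nf T p \<in> polys (dim_row T)" using p by simp
  have supp: "{d. f d \<noteq> \<zero>\<^bsub>?A\<^esub>} \<subseteq> D"
  proof
    fix d assume "d \<in> {d. f d \<noteq> \<zero>\<^bsub>?A\<^esub>}"
    then have "homogeneous_part d (nf T p) \<noteq> 0"
      by (auto simp: f_def zero_nil_algebra)
    then obtain m where "m \<in> keys (homogeneous_part d (nf T p))"
      by (metis ex_in_conv keys_eq_empty)
    then show "d \<in> D" unfolding D_def by (auto dest!: keys_homogeneous_part)
  qed
  have "f d \<in> component ?A d" for d
    unfolding f_def component_nil_algebra
    using nf by (intro imageI) (simp add: homogeneous_homogeneous_part)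
  moreover have fin: "finite {d. f d \<noteq> \<zero>\<^bsub>?A\<^esub>}"
    using supp by (rule finite_subset) (simp add: D_def)
  moreover have "a = (\<Oplus>\<^bsub>?A\<^esub>d \<in> {d. f d \<noteq> \<zero>\<^bsub>?A\<^esub>}. f d)"
  proof -
    \<comment> \<open>\<open>D\<close> may contain degrees whose part has zero coset; they add
      nothing to the sum.\<close>
    have "(\<Oplus>\<^bsub>?A\<^esub>d \<in> {d. f d \<noteq> \<zero>\<^bsub>?A\<^esub>}. f d) = (\<Oplus>\<^bsub>?A\<^esub>d \<in> D. f d)"
    proof (rule add.finprod_mono_neutral_cong_left)
      show "f \<in> D \<rightarrow> carrier ?A"
        using nf by (auto simp: f_def carrier_nil_algebra)
    qed (use supp in \<open>auto simp: D_def\<close>)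
    also have "\<dots> = coset T (\<Sum>d\<in>D. homogeneous_part d (nf T p))"
      unfolding f_def using nf by (intro coset_sum) (auto simp: D_def)
    also have "\<dots> = a"
      using p by (simp add: D_def sum_homogeneous_part coset_normal_form)
    finally show ?thesis ..
  qed
  moreover have "g = f"
    if g: "\<forall>d. g d \<in> component ?A d" "finite {d. g d \<noteq> \<zero>\<^bsub>?A\<^esub>}"
      "a = (\<Oplus>\<^bsub>?A\<^esub>d \<in> {d. g d \<noteq> \<zero>\<^bsub>?A\<^esub>}. g d)" for g
  proof
    fix d
    let ?S = "{d. g d \<noteq> \<zero>\<^bsub>?A\<^esub>}"
    \<comment> \<open>A homogeneous representative is chosen in each degree; its normal form stays
      homogeneous of that degree.\<close>
    from g(1) have "\<forall>d. \<exists>q. q \<in> polys (dim_row T) \<and> homogeneous d q \<and> g d = coset T q"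
      unfolding component_nil_algebra by blast
    then obtain q where q: "\<And>d. q d \<in> polys (dim_row T)" "\<And>d. homogeneous d (q d)"
      "\<And>d. g d = coset T (q d)" by metis
    have "a = coset T (\<Sum>d\<in>?S. q d)"
      using g(2,3) q(1,3) by (simp add: coset_sum)
    then have "nf T p = nf T (\<Sum>d\<in>?S. q d)"
      using p q(1) by (simp add: coset_eq_iff polys_sum)
    then have "homogeneous_part d (nf T p) = (\<Sum>e\<in>?S. homogeneous_part d (nf T (q e)))"
      by (simp add: normal_form_sum homogeneous_part_def linear_ext_sum)
    also have "\<dots> = (\<Sum>e\<in>?S. if d = e then nf T (q e) else 0)"
      by (intro sum.cong refl homogeneous_part_homogeneous homogeneous_normal_form q(2))
    also have "\<dots> = (if d \<in> ?S then nf T (q d) else 0)"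
      using g(2) by (simp add: sum.delta)
    finally have "f d = (if d \<in> ?S then g d else \<zero>\<^bsub>?A\<^esub>)"
      using q(1,3) by (simp add: f_def coset_normal_form zero_nil_algebra)
    then show "g d = f d" by simp
  qed
  ultimately show ?thesis by (intro ex1I[of _ f]) auto
qed

lemma comm_graded_algebra_nil_algebra: "comm_graded_algebra (nil_algebra T)"
  unfolding comm_graded_algebra_def
proof (intro conjI allI ballI)
  fix d e x y
  assume "x \<in> component (nil_algebra T) d" "y \<in> component (nil_algebra T) e"
  then show "x \<otimes>\<^bsub>nil_algebra T\<^esub> y \<in> component (nil_algebra T) (d + e)"
    by (auto simp: component_nil_algebra coset_mult homogeneous_mult)
qed (simp_all add: algebra_nil_algebra subspace_component component_decomposition)


subsection \<open>Generators and relations\<close>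

text \<open>A monomial is a product of variables, by induction on the total degree, and a polynomial
  is a linear combination of monomials, so \<open>B\<close> contains every coset.\<close>

lemma generates_nil_algebra:
  fixes T :: "'a::field mat"
  shows "generates_algebra (nil_algebra T) ((\<lambda>i. coset T (Var i)) ` {..<dim_row T})"
  unfolding generates_algebra_def
proof (intro conjI allI impI)
  let ?A = "nil_algebra T" and ?P = "polys (dim_row T) :: 'a mpoly set"
  show "(\<lambda>i. coset T (Var i)) ` {..<dim_row T} \<subseteq> carrier ?A"
    by (auto simp: carrier_nil_algebra)
  fix B
  assume B: "subring B ?A \<and> VectorSpace.subspace class_ring B ?A \<and>
    (\<lambda>i. coset T (Var i)) ` {..<dim_row T} \<subseteq> B"
  note ring = subringE[OF conjunct1[OF B]]
  have smult: "c \<odot>\<^bsub>?A\<^esub> b \<in> B" if "b \<in> B" for c b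
    using submodule.smult_closed[of class_ring B ?A c b] B that by (simp add: subspace_def)
  have mono: "coset T (single m 1) \<in> B" if "single m 1 \<in> ?P" for m
    using that
  proof (induction "total_degree m" arbitrary: m)
    case 0
    have "m = 0"
      using 0 by (intro poly_mapping_eqI) (auto simp: total_degree_def in_keys_iff)
    then show ?case using ring(3) by (simp add: one_nil_algebra)
  next
    case (Suc e)
    then have "m \<noteq> 0" by auto
    then obtain i where "i \<in> keys m" by (metis ex_in_conv keys_eq_empty)
    then have i: "lookup m i \<noteq> 0" by (simp add: in_keys_iff)
    \<comment> \<open>One factor \<open>X\<^sub>i\<close> is split off, which lowers the degree by
      one.\<close>
    define m' where "m' = m - single i 1"
    have m: "m = single i 1 + m'"
      unfolding m'_def using i
      by (intro poly_mapping_eqI) (auto simp: lookup_add lookup_minus lookup_single when_def)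
    have vars: "\<forall>j\<ge>dim_row T. lookup m j = 0"
      using Suc.prems by (simp add: polys_iff)
    from this[rule_format, of i] have "i < dim_row T"
      using i by (cases "dim_row T \<le> i") simp_all
    have "single m' 1 \<in> ?P"
      using vars by (simp add: polys_iff m'_def lookup_minus)
    moreover have "e = total_degree m'"
      using Suc(2) m by simp
    ultimately have "coset T (single m' 1) \<in> B" using Suc(1) by blast
    moreover have "coset T (Var i) \<in> B" using B \<open>i < dim_row T\<close> by blast
    ultimately have "coset T (Var i) \<otimes>\<^bsub>?A\<^esub> coset T (single m' 1) \<in> B" by (intro ring(6))
    also have "coset T (Var i) \<otimes>\<^bsub>?A\<^esub> coset T (single m' 1) = coset T (single m 1)"
      using \<open>i < dim_row T\<close> \<open>single m' 1 \<in> ?P\<close>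
      by (simp add: coset_mult m) (simp add: Var_def mult_single)
    finally show ?case .
  qed
  have "coset T p \<in> B" if p: "p \<in> ?P" for p
  proof -
    have *: "single m c \<in> ?P" if "m \<in> keys p" for m c
      using p that by (simp add: polys_iff)
    have "coset T (\<Sum>m\<in>S. Const (lookup p m) * single m 1) \<in> B"
      if "finite S" "S \<subseteq> keys p" for S
      using that
    proof (induction S)
      case empty
      show ?case using ring(2) by (simp add: zero_nil_algebra)
    next
      case (insert m S)
      have "coset T (Const (lookup p m) * single m 1) \<in> B"
        using smult[OF mono[OF *]] insert.prems by (simp add: coset_smult[OF *])
      with insert have "coset T (Const (lookup p m) * single m 1) \<oplus>\<^bsub>?A\<^esub>
          coset T (\<Sum>m\<in>S. Const (lookup p m) * single m 1) \<in> B"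
        by (intro ring(7)) auto
      moreover have "Const (lookup p m) * single m 1 \<in> ?P"
        "(\<Sum>m\<in>S. Const (lookup p m) * single m 1) \<in> ?P"
        using insert.prems by (auto intro!: polys_sum *)
      ultimately show ?case
        using insert.hyps by (simp add: coset_add del: Const_mult_single)
    qed
    from this[of "keys p"] show ?thesis
      using poly_mapping_expand[of "keys p" p] by simp
  qed
  then show "B = carrier ?A"
    using ring(1) by (auto simp: carrier_nil_algebra)
qed

lemma coset_Var_relation:
  assumes "i < dim_row T"
  shows "coset T (Var i) \<otimes>\<^bsub>nil_algebra T\<^esub> coset T (Var i) =
    (\<Oplus>\<^bsub>nil_algebra T\<^esub>j \<in> {..<i}. T $$ (i, j) \<odot>\<^bsub>nil_algebra T\<^esub>
      (coset T (Var j) \<otimes>\<^bsub>nil_algebra T\<^esub> coset T (Var i)))"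
proof -
  interpret cring "nil_algebra T" by (rule cring_nil_algebra)
  have "(\<Oplus>\<^bsub>nil_algebra T\<^esub>j \<in> {..<i}. T $$ (i, j) \<odot>\<^bsub>nil_algebra T\<^esub>
      (coset T (Var j) \<otimes>\<^bsub>nil_algebra T\<^esub> coset T (Var i)))
    = (\<Oplus>\<^bsub>nil_algebra T\<^esub>j \<in> {..<i}. coset T (Const (T $$ (i, j)) * (Var j * Var i)))"
    using assms
    by (intro finsum_cong') (auto simp: coset_mult coset_smult carrier_nil_algebra)
  also have "\<dots> = coset T (linear_part T i * Var i)"
    using assms
    by (subst coset_sum) (auto simp: linear_part_def sum_distrib_right mult.assoc)
  also have "\<dots> = coset T (Var i * Var i)"
  proof -
    \<comment> \<open>This is the relation itself, stated through normal forms and obtained with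
      cofactor 1.\<close>
    have "nf T (nil_relator T i) = 0"
      using normal_form_relator_mult[OF assms, of T 1] by simp
    then show ?thesis
      using assms
      by (simp add: coset_eq_iff nil_relator_eq normal_form_diff power2_eq_square)
  qed
  finally show ?thesis
    using assms by (simp add: coset_mult)
qed

lemma weakly_associated_nil_algebra: "weakly_associated T (nil_algebra T)"
  unfolding weakly_associated_def
proof (intro conjI exI allI impI)
  show "comm_graded_algebra (nil_algebra T)"
    by (rule comm_graded_algebra_nil_algebra)
  show "coset T (Var i) \<in> component (nil_algebra T) 2" if "i < dim_row T" for i
    using that by (auto simp: component_nil_algebra homogeneous_def keys_Var intro!: imageI)
qed (rule generates_nil_algebra, rule coset_Var_relation)


subsection \<open>A basis of squarefree monomials\<close>

text \<open>The bound 0 from \<open>n\<close> on excludes the variables outside the polynomial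
  ring.\<close>

definition squarefree_monoms :: "nat \<Rightarrow> (nat \<Rightarrow>\<^sub>0 nat) set" where
  "squarefree_monoms n = {m. \<forall>j. lookup m j \<le> (if j < n then 1 else 0)}"

text \<open>A squarefree monomial is determined by the set of variables dividing it; finiteness and
  the count \<open>2 ^ n\<close> follow from this.\<close>

lemma bij_betw_keys_squarefree_monoms: "bij_betw keys (squarefree_monoms n) (Pow {..<n})"
proof (rule bij_betw_imageI)
  show "inj_on keys (squarefree_monoms n)"
  proof (rule inj_onI, rule poly_mapping_eqI)
    fix a b j
    assume ab: "a \<in> squarefree_monoms n" "b \<in> squarefree_monoms n" and "keys a = keys b"
    then have "lookup a j = 0 \<longleftrightarrow> lookup b j = 0" by (metis in_keys_iff)
    moreover have "lookup a j \<le> 1" "lookup b j \<le> 1"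
      using ab by (auto simp: squarefree_monoms_def split: if_splits intro: order_trans)
    ultimately show "lookup a j = lookup b j" by linarith
  qed
  show "keys ` squarefree_monoms n = Pow {..<n}"
  proof (intro equalityI subsetI)
    fix S assume "S \<in> keys ` squarefree_monoms n"
    then show "S \<in> Pow {..<n}"
      by (fastforce simp: squarefree_monoms_def in_keys_iff split: if_splits)
  next
    fix S assume "S \<in> Pow {..<n}"
    then have S: "S \<subseteq> {..<n}" "finite S" by (auto intro: finite_subset)
    \<comment> \<open>The product of the variables in \<open>S\<close>, written as a sum because
      monomials are exponent functions.\<close>
    define m :: "nat \<Rightarrow>\<^sub>0 nat" where "m = (\<Sum>i\<in>S. single i 1)"
    have m: "lookup m j = (if j \<in> S then 1 else 0)" for j
      using S(2) by (simp add: m_def lookup_sum lookup_single when_def)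
    then have "keys m = S" "m \<in> squarefree_monoms n"
      using S(1) by (auto simp: in_keys_iff squarefree_monoms_def split: if_splits)
    then show "S \<in> keys ` squarefree_monoms n" by blast
  qed
qed

lemma finite_squarefree_monoms [simp]: "finite (squarefree_monoms n)"
  using bij_betw_finite[OF bij_betw_keys_squarefree_monoms] by simp

lemma card_squarefree_monoms: "card (squarefree_monoms n) = 2 ^ n"
  using bij_betw_same_card[OF bij_betw_keys_squarefree_monoms] by (simp add: card_Pow)

lemma nf_squarefree:
  assumes "keys p \<subseteq> squarefree_monoms (dim_row T)"
  shows "nf T p = p"
proof (rule normal_form_squarefree)
  fix m j assume "m \<in> keys p"
  with assms have "m \<in> squarefree_monoms (dim_row T)" by blast
  then have "lookup m j \<le> (if j < dim_row T then 1 else 0)"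
    unfolding squarefree_monoms_def by blast
  then show "lookup m j \<le> 1" by (simp split: if_splits)
qed

lemma polys_squarefree:
  assumes "keys p \<subseteq> squarefree_monoms n"
  shows "p \<in> polys n"
  unfolding polys_iff
proof (intro ballI allI impI)
  fix m j assume "m \<in> keys p" and "n \<le> j"
  with assms have "m \<in> squarefree_monoms n" by blast
  then have "lookup m j \<le> (if j < n then 1 else 0)"
    unfolding squarefree_monoms_def by blast
  with \<open>n \<le> j\<close> show "lookup m j = 0" by simp
qed

lemma keys_nf:
  assumes "p \<in> polys (dim_row T)"
  shows "keys (nf T p) \<subseteq> squarefree_monoms (dim_row T)"
proof
  fix m' assume "m' \<in> keys (nf T p)"
  from keys_normal_form[OF this] obtain m where m: "m \<in> keys p"
    "\<forall>j<dim_row T. lookup m' j \<le> 1" "\<forall>j\<ge>dim_row T. lookup m' j = lookup m j" by blast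
  with assms have "\<forall>j\<ge>dim_row T. lookup m' j = 0" by (simp add: polys_iff)
  with m(2) show "m' \<in> squarefree_monoms (dim_row T)" by (simp add: squarefree_monoms_def)
qed

text \<open>The cosets of the squarefree monomials form a basis: they span because each coset
  contains a normal form, and are independent because squarefree polynomials are their own normal
  forms.\<close>

lemma dim_nil_algebra:
  fixes T :: "'a::field mat"
  shows "vectorspace.fin_dim class_ring (nil_algebra T) \<and>
    vectorspace.dim class_ring (nil_algebra T) = 2 ^ dim_row T"
proof -
  let ?A = "nil_algebra T" and ?M = "squarefree_monoms (dim_row T)"
  interpret V: vectorspace class_ring ?A by (rule vectorspace_nil_algebra)
  define g where "g m = coset T (single m 1)" for m
  have M: "single m c \<in> polys (dim_row T)" if "m \<in> ?M" for m and c :: 'a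
    using that by (intro polys_squarefree) simp
  have gA: "g ` ?M \<subseteq> carrier ?A"
    using M by (auto simp: g_def carrier_nil_algebra)
  have inj: "inj_on g ?M"
  proof (rule inj_onI)
    fix a b assume ab: "a \<in> ?M" "b \<in> ?M" "g a = g b"
    then have "nf T (single a 1) = nf T (single b 1)"
      by (simp add: g_def coset_eq_iff M)
    then have "single a (1::'a) = single b 1"
      using ab by (simp add: nf_squarefree)
    then have "lookup (single a (1::'a)) b = lookup (single b 1) b" by simp
    then show "a = b" by (simp add: lookup_single when_def split: if_splits)
  qed
  have lincomb: "V.lincomb c (g ` ?M) = coset T (\<Sum>m\<in>?M. single m (c (g m)))" for c
  proof -
    \<comment> \<open>A linear combination is indexed by the cosets; injectivity of \<open>g\<close>
      turns it into a sum over monomials.\<close>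
    have "V.lincomb c (g ` ?M) = (\<Oplus>\<^bsub>?A\<^esub>m\<in>?M. c (g m) \<odot>\<^bsub>?A\<^esub> g m)"
      unfolding V.lincomb_def using gA inj by (intro V.M.finsum_reindex) auto
    also have "\<dots> = (\<Oplus>\<^bsub>?A\<^esub>m\<in>?M. coset T (single m (c (g m))))"
      using M by (intro V.M.finsum_cong') (auto simp: g_def coset_smult carrier_nil_algebra)
    also have "\<dots> = coset T (\<Sum>m\<in>?M. single m (c (g m)))"
      using M by (intro coset_sum) simp_all
    finally show ?thesis .
  qed
  have "V.lin_indpt (g ` ?M)"
  proof (rule V.finite_lin_indpt2[OF _ gA])
    fix c assume "V.lincomb c (g ` ?M) = \<zero>\<^bsub>?A\<^esub>"
    then have eq: "coset T (\<Sum>m\<in>?M. single m (c (g m))) = coset T 0"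
      by (simp add: lincomb zero_nil_algebra)
    have sub: "keys (\<Sum>m\<in>?M. single m (c (g m))) \<subseteq> ?M"
      by (auto dest!: mem_keys_sum split: if_splits)
    \<comment> \<open>Both representatives equal their normal forms, so equal cosets force equal
      polynomials.\<close>
    have zero: "(\<Sum>m\<in>?M. single m (c (g m))) = 0"
      using eq by (simp add: coset_eq_iff polys_squarefree[OF sub] nf_squarefree[OF sub])
    have "c (g m) = 0" if "m \<in> ?M" for m
    proof -
      have "0 = (\<Sum>a\<in>?M. lookup (single a (c (g a))) m)"
        using arg_cong[OF zero, of "\<lambda>p. lookup p m"] by (simp add: lookup_sum)
      also have "\<dots> = c (g m)"
        using that by (simp add: lookup_single when_def)
      finally show ?thesis ..
    qed
    then show "\<forall>v\<in>g ` ?M. c v = \<zero>\<^bsub>class_ring\<^esub>" by simp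
  qed simp
  moreover have "carrier ?A \<subseteq> V.span (g ` ?M)"
  proof
    fix a assume "a \<in> carrier ?A"
    then obtain p where p: "p \<in> polys (dim_row T)" "a = coset T p"
      unfolding carrier_nil_algebra by blast
    \<comment> \<open>Coefficients must be a function of the coset, so those of the normal form are
      pulled back along the inverse of \<open>g\<close>.\<close>
    define c where "c v = lookup (nf T p) (inv_into ?M g v)" for v
    have "a = coset T (nf T p)"
      using p by (simp add: coset_normal_form)
    also have "nf T p = (\<Sum>m\<in>?M. single m (lookup (nf T p) m))"
      using keys_nf[OF p(1)] by (intro poly_mapping_expand) simp_all
    also have "\<dots> = (\<Sum>m\<in>?M. single m (c (g m)))"
      using inj by (intro sum.cong) (simp_all add: c_def)
    finally have "a = V.lincomb c (g ` ?M)" by (simp add: lincomb)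
    then show "a \<in> V.span (g ` ?M)"
      using gA by (auto simp: V.finite_span)
  qed
  then have gen: "V.span (g ` ?M) = carrier ?A"
    using V.span_is_subset2[OF gA] by blast
  ultimately have "V.basis (g ` ?M)"
    using gA by (simp add: V.basis_def)
  then have "V.dim = card (g ` ?M)"
    by (intro V.dim_basis) simp_all
  moreover have "V.fin_dim"
    unfolding V.fin_dim_def using gA gen by (intro exI[of _ "g ` ?M"]) simp
  ultimately show ?thesis
    by (simp add: card_image[OF inj] card_squarefree_monoms)
qed

theorem theorem2p9:
  fixes T :: "'a::field mat" and n :: nat
  assumes "CHAR('a) \<noteq> 2"
    and "T \<in> carrier_mat n n"
    and "strictly_lower_triangular T"
  shows "strongly_associated T (nil_algebra T)"
  unfolding strongly_associated_def
  using weakly_associated_nil_algebra dim_nil_algebra by blast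

end
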